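(* Let $k$ be a field and $G$ a finite group, and let $X$ be a set of representatives of the conjugacy classes of $G$. For $x\in X$ and $s\ge0$, the Connes operator $B:C_s(kG,kG)\to C_{s+1}(kG,kG)$ restricts to an operator $B_x:\mathcal H_{x,s}\to\mathcal H_{x,s+1}$.
   Context: $\overline G=G\setminus\{1\}$; $g_{i,j}$ denotes the sequence $g_i,\dots,g_j$ (empty if $j<i$). $C_s(kG,kG)=k[G\times\overline G^{\times s}]$ is the space of normalized Hochschild $s$-chains of $kG$, where a tuple with an entry $1$ in one of the $\overline G$-positions is $0$. The Connes operator is $B(g_0,g_{1,s})=\sum_{i=0}^s(-1)^{is}(1,g_{i,s},g_{0,i-1})$. $C_x$ denotes the conjugacy class of $x$, and $\mathcal H_{x,s}=k[(g_s^{-1}\cdots g_1^{-1}u,g_{1,s}):u\in C_x,\ g_1,\dots,g_s\in\overline G]\subset C_s(kG,kG)$. *)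

theory Defs
  imports Complex_Main "HOL-Algebra.Group" "HOL-Library.Poly_Mapping"
begin

definition scale :: "'k::field \<Rightarrow> ('b \<Rightarrow>\<^sub>0 'k) \<Rightarrow> 'b \<Rightarrow>\<^sub>0 'k"
  where "scale r c = Poly_Mapping.map ((*) r) c"

lemma lookup_scale [simp]: "Poly_Mapping.lookup (scale r c) b = r * Poly_Mapping.lookup c b"
  by (simp add: scale_def Poly_Mapping.map.rep_eq when_def)

interpretation chains: vector_space "scale :: 'k::field \<Rightarrow> ('b \<Rightarrow>\<^sub>0 'k) \<Rightarrow> 'b \<Rightarrow>\<^sub>0 'k"
  by unfold_locales
    (auto intro!: poly_mapping_eqI simp: lookup_add distrib_left distrib_right)

text \<open>The vector space \<open>k[S]\<close> with basis \<open>S\<close>, realised inside the space of all finitely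
  supported functions.\<close>

definition free_space :: "'b set \<Rightarrow> ('b \<Rightarrow>\<^sub>0 'k::field) set"
  where "free_space S = {c. Poly_Mapping.keys c \<subseteq> S}"

lemma subspace_free_space: "chains.subspace (free_space S :: ('b \<Rightarrow>\<^sub>0 'k::field) set)"
  unfolding chains.subspace_def
proof (intro conjI ballI allI)
  fix x y :: "'b \<Rightarrow>\<^sub>0 'k" and r :: 'k
  assume x: "x \<in> free_space S"
  show "scale r x \<in> free_space S"
    using x by (auto simp: free_space_def in_keys_iff)
  assume y: "y \<in> free_space S"
  show "x + y \<in> free_space S"
    using x y Poly_Mapping.keys_add[of x y] by (auto simp: free_space_def)
qed (simp add: free_space_def)

text \<open>A tuple \<open>(g\<^sub>0, g\<^sub>1, \<dots>, g\<^sub>s)\<close> is represented as \<open>(g0, [g1, \<dots>, gs])\<close>.\<close>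

definition nontriv :: "('g, 'm) monoid_scheme \<Rightarrow> 'g set"
  where "nontriv G = carrier G - {\<one>\<^bsub>G\<^esub>}"

definition hochschild_chains ::
    "('g, 'm) monoid_scheme \<Rightarrow> nat \<Rightarrow> ('g \<times> 'g list \<Rightarrow>\<^sub>0 'k::field) set"
  where "hochschild_chains G s =
    free_space {(g0, gs). g0 \<in> carrier G \<and> set gs \<subseteq> nontriv G \<and> length gs = s}"

text \<open>The chain denoted by a tuple, with the normalization convention that it vanishes as soon as
  one of the entries after the first is \<open>1\<close>.\<close>

definition tuple_chain ::
    "('g, 'm) monoid_scheme \<Rightarrow> 'g \<times> 'g list \<Rightarrow> ('g \<times> 'g list \<Rightarrow>\<^sub>0 'k::field)"
  where "tuple_chain G t = (if \<one>\<^bsub>G\<^esub> \<in> set (snd t) then 0 else Poly_Mapping.single t 1)"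

text \<open>With \<open>l = [g0, \<dots>, gs]\<close>, \<open>drop i l\<close> is \<open>g\<^sub>i, \<dots>, g\<^sub>s\<close> and \<open>take i l\<close> is
  \<open>g\<^sub>0, \<dots>, g\<^sub>i\<^sub>-\<^sub>1\<close>. The degree \<open>s\<close> is read off the tuple, so the operators
  of all degrees are given by a single linear map.\<close>

definition connes_tuple ::
    "('g, 'm) monoid_scheme \<Rightarrow> 'g \<times> 'g list \<Rightarrow> ('g \<times> 'g list \<Rightarrow>\<^sub>0 'k::field)"
  where "connes_tuple G t = (let l = fst t # snd t; s = length (snd t) in
    \<Sum>i = 0..s. scale ((- 1) ^ (i * s)) (tuple_chain G (\<one>\<^bsub>G\<^esub>, drop i l @ take i l)))"

definition connes ::
    "('g, 'm) monoid_scheme \<Rightarrow> ('g \<times> 'g list \<Rightarrow>\<^sub>0 'k::field) \<Rightarrow> ('g \<times> 'g list \<Rightarrow>\<^sub>0 'k)"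
  where "connes G c =
    (\<Sum>t\<in>Poly_Mapping.keys c. scale (Poly_Mapping.lookup c t) (connes_tuple G t))"

lemma connes_superset:
  assumes "finite A" "Poly_Mapping.keys c \<subseteq> A"
  shows "connes G c = (\<Sum>t\<in>A. scale (Poly_Mapping.lookup c t) (connes_tuple G t))"
  unfolding connes_def
  by (rule sum.mono_neutral_left) (use assms in \<open>auto simp: in_keys_iff\<close>)

lemma linear_connes:
  "Vector_Spaces.linear scale scale
     (connes G :: ('g \<times> 'g list \<Rightarrow>\<^sub>0 'k::field) \<Rightarrow> ('g \<times> 'g list \<Rightarrow>\<^sub>0 'k))"
proof unfold_locales
  fix a b :: "'g \<times> 'g list \<Rightarrow>\<^sub>0 'k" and r :: 'k
  let ?A = "Poly_Mapping.keys a \<union> Poly_Mapping.keys b"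
  have "connes G (a + b) =
      (\<Sum>t\<in>?A. scale (Poly_Mapping.lookup (a + b) t) (connes_tuple G t))"
    by (rule connes_superset) (simp_all add: Poly_Mapping.keys_add)
  moreover have "connes G a = (\<Sum>t\<in>?A. scale (Poly_Mapping.lookup a t) (connes_tuple G t))"
    and "connes G b = (\<Sum>t\<in>?A. scale (Poly_Mapping.lookup b t) (connes_tuple G t))"
    by (simp_all add: connes_superset)
  ultimately show "connes G (a + b) = connes G a + connes G b"
    by (simp add: lookup_add chains.scale_left_distrib sum.distrib)
  have "connes G (scale r a) =
      (\<Sum>t\<in>Poly_Mapping.keys a. scale (Poly_Mapping.lookup (scale r a) t) (connes_tuple G t))"
    by (rule connes_superset) (auto simp: in_keys_iff)
  then show "connes G (scale r a) = scale r (connes G a)"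
    by (simp add: connes_def chains.scale_sum_right)
qed

lemma connes_in_hochschild_chains:
  fixes c :: "'g \<times> 'g list \<Rightarrow>\<^sub>0 'k::field"
  assumes "group G" "c \<in> hochschild_chains G s"
  shows "connes G c \<in> hochschild_chains G (Suc s)"
proof -
  interpret group G by fact
  have sub: "chains.subspace (hochschild_chains G n :: ('g \<times> 'g list \<Rightarrow>\<^sub>0 'k) set)" for n
    by (simp add: hochschild_chains_def subspace_free_space)
  have "connes_tuple G t \<in> (hochschild_chains G (Suc s) :: ('g \<times> 'g list \<Rightarrow>\<^sub>0 'k) set)"
    if "t \<in> Poly_Mapping.keys c" for t
  proof -
    have t: "set (fst t # snd t) \<subseteq> carrier G" "length (snd t) = s"
      using that assms(2)
      by (cases t; force simp: hochschild_chains_def free_space_def nontriv_def)+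
    show ?thesis
      unfolding connes_tuple_def Let_def
    proof (intro chains.subspace_sum[OF sub] chains.subspace_scale[OF sub])
      fix i assume i: "i \<in> {0..length (snd t)}"
      let ?l = "fst t # snd t"
      have "set (drop i ?l @ take i ?l) \<subseteq> carrier G"
        using t(1) set_drop_subset[of i ?l] set_take_subset[of i ?l]
        by (metis append_take_drop_id set_append sup_commute)
      moreover have "length (drop i ?l @ take i ?l) = Suc s"
        using i t(2) by simp
      ultimately show "tuple_chain G (\<one>\<^bsub>G\<^esub>, drop i ?l @ take i ?l)
          \<in> (hochschild_chains G (Suc s) :: ('g \<times> 'g list \<Rightarrow>\<^sub>0 'k) set)"
        unfolding hochschild_chains_def free_space_def tuple_chain_def nontriv_def
        by (simp del: set_append) blast
    qed
  qed
  then show ?thesis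
    unfolding connes_def by (intro chains.subspace_sum[OF sub] chains.subspace_scale[OF sub])
qed

definition conj_class :: "('g, 'm) monoid_scheme \<Rightarrow> 'g \<Rightarrow> 'g set"
  where "conj_class G x = {g \<otimes>\<^bsub>G\<^esub> x \<otimes>\<^bsub>G\<^esub> inv\<^bsub>G\<^esub> g | g. g \<in> carrier G}"

definition conj_class_reps :: "('g, 'm) monoid_scheme \<Rightarrow> 'g set \<Rightarrow> bool"
  where "conj_class_reps G X \<longleftrightarrow>
    X \<subseteq> carrier G \<and> (\<forall>y\<in>carrier G. \<exists>!x. x \<in> X \<and> y \<in> conj_class G x)"

text \<open>The \<open>foldr\<close> term is \<open>g\<^sub>s\<^sup>-\<^sup>1 \<cdots> g\<^sub>1\<^sup>-\<^sup>1 u\<close>.\<close>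

definition conj_chains ::
    "('g, 'm) monoid_scheme \<Rightarrow> 'g \<Rightarrow> nat \<Rightarrow> ('g \<times> 'g list \<Rightarrow>\<^sub>0 'k::field) set"
  where "conj_chains G x s =
    free_space {(foldr (\<otimes>\<^bsub>G\<^esub>) (rev (map (m_inv G) gs)) u, gs) | u gs.
      u \<in> conj_class G x \<and> set gs \<subseteq> nontriv G \<and> length gs = s}"

lemma conj_chains_subset:
  assumes "group G" "x \<in> carrier G"
  shows "(conj_chains G x s :: ('g \<times> 'g list \<Rightarrow>\<^sub>0 'k::field) set) \<subseteq> hochschild_chains G s"
proof -
  interpret group G by fact
  have "foldr (\<otimes>\<^bsub>G\<^esub>) hs u \<in> carrier G" if "set hs \<subseteq> carrier G" "u \<in> carrier G" for hs u
    using that by (induction hs) auto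
  moreover have "set (rev (map (m_inv G) gs)) \<subseteq> carrier G" if "set gs \<subseteq> nontriv G" for gs
    using that by (auto simp: nontriv_def)
  moreover have "u \<in> carrier G" if "u \<in> conj_class G x" for u
    using that assms(2) by (auto simp: conj_class_def)
  ultimately have "foldr (\<otimes>\<^bsub>G\<^esub>) (rev (map (m_inv G) gs)) u \<in> carrier G"
    if "set gs \<subseteq> nontriv G" "u \<in> conj_class G x" for gs u
    using that by blast
  then show ?thesis
    unfolding conj_chains_def hochschild_chains_def free_space_def by blast
qed

end

theory Submission
  imports Defs
begin

text \<open>
  A tuple \<open>(g\<^sub>0, g\<^sub>1, \<dots>, g\<^sub>s)\<close> lies in the basis of \<open>conj_chains G x s\<close> exactly when the product
  \<open>u = g\<^sub>1 \<cdots> g\<^sub>s g\<^sub>0\<close> lies in the conjugacy class of \<open>x\<close> (lemma \<open>conj_chains_eq_free_space\<close>).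
  This product is cyclic in nature: moving an initial segment of the factors to the end conjugates
  it, because \<open>b a = b (a b) b\<^sup>-\<^sup>1\<close> (lemma \<open>conj_class_list_prod_swap\<close>). For the tuple
  \<open>(1, g\<^sub>i, \<dots>, g\<^sub>s, g\<^sub>0, \<dots>, g\<^sub>i\<^sub>-\<^sub>1)\<close> of the Connes operator the corresponding product is
  \<open>g\<^sub>i \<cdots> g\<^sub>s g\<^sub>0 \<cdots> g\<^sub>i\<^sub>-\<^sub>1\<close>, a rotation of \<open>u\<close>, so every nonzero summand of the image
  of a basis tuple is, up to sign, again a basis tuple for \<open>x\<close>. Linearity does the rest.
\<close>

abbreviation (in monoid) list_prod :: "'a list \<Rightarrow> 'a"
  where "list_prod gs \<equiv> foldr (\<otimes>) gs \<one>"

context group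
begin

lemma list_prod_closed:
  "set gs \<subseteq> carrier G \<Longrightarrow> list_prod gs \<in> carrier G"
  by (induction gs) auto

lemma list_prod_append:
  "set as \<subseteq> carrier G \<Longrightarrow> set bs \<subseteq> carrier G \<Longrightarrow>
    list_prod (as @ bs) = list_prod as \<otimes> list_prod bs"
  by (induction as) (auto simp: m_assoc list_prod_closed)

lemma foldr_rev_map_inv:
  assumes "set gs \<subseteq> carrier G" "u \<in> carrier G"
  shows "foldr (\<otimes>) (rev (map (m_inv G) gs)) u = inv (list_prod gs) \<otimes> u"
  using assms
  by (induction gs arbitrary: u) (auto simp: inv_mult_group m_assoc list_prod_closed)

lemma conj_class_subset_carrier:
  "x \<in> carrier G \<Longrightarrow> conj_class G x \<subseteq> carrier G"
  by (auto simp: conj_class_def)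

lemma conj_class_conj:
  assumes "x \<in> carrier G" "y \<in> conj_class G x" "b \<in> carrier G"
  shows "b \<otimes> y \<otimes> inv b \<in> conj_class G x"
proof -
  from assms(2) obtain g where g: "g \<in> carrier G" "y = g \<otimes> x \<otimes> inv g"
    by (auto simp: conj_class_def)
  then have "b \<otimes> y \<otimes> inv b = (b \<otimes> g) \<otimes> x \<otimes> inv (b \<otimes> g)"
    using assms by (simp add: inv_mult_group m_assoc)
  then show ?thesis
    using g assms(3) by (auto simp: conj_class_def)
qed

text \<open>Up to conjugacy a product depends only on the cyclic order of its factors, since
  \<open>b (a b) b\<^sup>-\<^sup>1 = b a\<close>.\<close>

lemma conj_class_list_prod_swap:
  assumes "x \<in> carrier G" "set as \<subseteq> carrier G" "set bs \<subseteq> carrier G"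
    and "list_prod (as @ bs) \<in> conj_class G x"
  shows "list_prod (bs @ as) \<in> conj_class G x"
proof -
  let ?a = "list_prod as" and ?b = "list_prod bs"
  have ab: "?a \<in> carrier G" "?b \<in> carrier G"
    using assms by (simp_all add: list_prod_closed)
  have "?b \<otimes> (?a \<otimes> ?b) \<otimes> inv ?b \<in> conj_class G x"
    using conj_class_conj[OF assms(1) _ ab(2)] assms(2-4) by (simp only: list_prod_append)
  moreover have "?b \<otimes> (?a \<otimes> ?b) \<otimes> inv ?b = ?b \<otimes> ?a"
    using ab by (simp add: m_assoc)
  ultimately show ?thesis
    using assms(2,3) by (simp only: list_prod_append)
qed

text \<open>Solving \<open>g\<^sub>0 = g\<^sub>s\<^sup>-\<^sup>1 \<cdots> g\<^sub>1\<^sup>-\<^sup>1 u\<close> for \<open>u\<close> turns the parametrised basis into a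
  condition on the tuple alone, which can be tested on the tuples that \<open>connes_tuple\<close> produces.\<close>

lemma conj_chains_eq_free_space:
  assumes x: "x \<in> carrier G"
  shows "(conj_chains G x s :: ('a \<times> 'a list \<Rightarrow>\<^sub>0 'k::field) set) =
    free_space {(g0, gs). g0 \<in> carrier G \<and> set gs \<subseteq> nontriv G \<and> length gs = s \<and>
      list_prod (gs @ [g0]) \<in> conj_class G x}" (is "_ = free_space ?B")
proof -
  have *: "foldr (\<otimes>) (rev (map (m_inv G) gs)) u = g0 \<longleftrightarrow> u = list_prod (gs @ [g0])"
    if "set gs \<subseteq> nontriv G" "u \<in> carrier G" "g0 \<in> carrier G" for gs u g0
  proof -
    have gs: "set gs \<subseteq> carrier G"
      using that(1) by (auto simp: nontriv_def)
    then have "foldr (\<otimes>) (rev (map (m_inv G) gs)) u = inv (list_prod gs) \<otimes> u"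
      using that(2) by (rule foldr_rev_map_inv)
    moreover have "list_prod (gs @ [g0]) = list_prod gs \<otimes> g0"
      using gs that(3) by (subst list_prod_append) auto
    ultimately show ?thesis
      using that gs by (metis inv_solve_left list_prod_closed)
  qed
  have closed: "foldr (\<otimes>) (rev (map (m_inv G) gs)) u \<in> carrier G"
    if "set gs \<subseteq> nontriv G" "u \<in> carrier G" for gs u
  proof -
    have "set gs \<subseteq> carrier G"
      using that(1) by (auto simp: nontriv_def)
    then show ?thesis
      using that(2) by (simp add: foldr_rev_map_inv list_prod_closed)
  qed
  have "{(foldr (\<otimes>) (rev (map (m_inv G) gs)) u, gs) | u gs.
      u \<in> conj_class G x \<and> set gs \<subseteq> nontriv G \<and> length gs = s} = ?B" (is "?A = _")
  proof (intro equalityI subsetI)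
    fix t assume "t \<in> ?A"
    then obtain u gs where t: "t = (foldr (\<otimes>) (rev (map (m_inv G) gs)) u, gs)"
      and u: "u \<in> conj_class G x" and gs: "set gs \<subseteq> nontriv G" "length gs = s"
      by blast
    have uc: "u \<in> carrier G"
      using u conj_class_subset_carrier[OF x] by blast
    have "u = list_prod (gs @ [foldr (\<otimes>) (rev (map (m_inv G) gs)) u])"
      using *[OF gs(1) uc closed[OF gs(1) uc]] by blast
    then show "t \<in> ?B"
      using t u gs closed[OF gs(1) uc] by (simp del: foldr_append)
  next
    fix t assume "t \<in> ?B"
    then obtain g0 gs where t: "t = (g0, gs)" and g0: "g0 \<in> carrier G"
      and gs: "set gs \<subseteq> nontriv G" "length gs = s"
      and u: "list_prod (gs @ [g0]) \<in> conj_class G x"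
      by blast
    have "foldr (\<otimes>) (rev (map (m_inv G) gs)) (list_prod (gs @ [g0])) = g0"
      using *[OF gs(1) _ g0] u conj_class_subset_carrier[OF x] by blast
    then have "t = (foldr (\<otimes>) (rev (map (m_inv G) gs)) (list_prod (gs @ [g0])), gs)"
      using t by (simp only:)
    then show "t \<in> ?A"
      using u gs by blast
  qed
  then show ?thesis
    by (simp only: conj_chains_def)
qed

text \<open>The new leading entry \<open>1\<close> does not change the product, so each summand contributes a
  rotation of the original one.\<close>

lemma connes_tuple_in_conj_chains:
  assumes x: "x \<in> carrier G" and g0: "g0 \<in> carrier G" and gs: "set gs \<subseteq> carrier G"
    and prod: "list_prod (gs @ [g0]) \<in> conj_class G x"
  shows "connes_tuple G (g0, gs) \<in>
    (conj_chains G x (Suc (length gs)) :: ('a \<times> 'a list \<Rightarrow>\<^sub>0 'k::field) set)"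
proof -
  have sub: "chains.subspace (conj_chains G x n :: ('a \<times> 'a list \<Rightarrow>\<^sub>0 'k) set)" for n
    by (simp add: conj_chains_def subspace_free_space)
  let ?l = "g0 # gs"
  have l: "set ?l \<subseteq> carrier G"
    using g0 gs by simp
  \<comment> \<open>The class condition has \<open>g0\<close> last, whereas the Connes operator rotates a list with \<open>g0\<close>
    first; one swap reconciles the two.\<close>
  have prod_l: "list_prod ?l \<in> conj_class G x"
    using conj_class_list_prod_swap[OF x gs _ prod] g0 by simp
  have "tuple_chain G (\<one>, drop i ?l @ take i ?l)
      \<in> (conj_chains G x (Suc (length gs)) :: ('a \<times> 'a list \<Rightarrow>\<^sub>0 'k) set)"
    if i: "i \<le> length gs" for i
  proof -
    let ?r = "drop i ?l @ take i ?l"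
    have dt: "set (take i ?l) \<subseteq> carrier G" "set (drop i ?l) \<subseteq> carrier G"
      using l set_drop_subset[of i ?l] set_take_subset[of i ?l] by blast+
    have r: "set ?r \<subseteq> carrier G"
      using dt by simp
    have len: "length ?r = Suc (length gs)"
      using i by simp
    have "list_prod ?r \<in> conj_class G x"
      by (rule conj_class_list_prod_swap[OF x dt]) (simp only: append_take_drop_id prod_l)
    moreover have "list_prod (?r @ [\<one>]) = list_prod ?r"
      by simp
    ultimately have "list_prod (?r @ [\<one>]) \<in> conj_class G x"
      by (simp only:)
    then show ?thesis
      using r len
      unfolding conj_chains_eq_free_space[OF x] free_space_def tuple_chain_def nontriv_def
      by (auto simp del: set_append foldr_append)
  qed
  then show ?thesis
    unfolding connes_tuple_def Let_def
    by (intro chains.subspace_sum[OF sub] chains.subspace_scale[OF sub]) simp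
qed

end

theorem lemma6p3:
  fixes G (structure)
  assumes "group G" and "finite (carrier G)"
    and "conj_class_reps G X"
    and "x \<in> X"
  shows "connes G ` (conj_chains G x s :: ('g \<times> 'g list \<Rightarrow>\<^sub>0 'k::field) set)
    \<subseteq> conj_chains G x (Suc s)"
proof (rule image_subsetI)
  interpret group G by fact
  have x: "x \<in> carrier G"
    using assms(3,4) by (auto simp: conj_class_reps_def)
  have sub: "chains.subspace (conj_chains G x n :: ('g \<times> 'g list \<Rightarrow>\<^sub>0 'k) set)" for n
    by (simp add: conj_chains_def subspace_free_space)
  fix c :: "'g \<times> 'g list \<Rightarrow>\<^sub>0 'k"
  assume c: "c \<in> conj_chains G x s"
  have "connes_tuple G t \<in> (conj_chains G x (Suc s) :: ('g \<times> 'g list \<Rightarrow>\<^sub>0 'k) set)"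
    if "t \<in> Poly_Mapping.keys c" for t
  proof -
    obtain g0 gs where t: "t = (g0, gs)"
      by (cases t)
    have "g0 \<in> carrier G" "set gs \<subseteq> nontriv G" "length gs = s"
      "list_prod (gs @ [g0]) \<in> conj_class G x"
      using c that unfolding conj_chains_eq_free_space[OF x] free_space_def t by blast+
    then show ?thesis
      using connes_tuple_in_conj_chains[OF x, of g0 gs] t by (auto simp: nontriv_def)
  qed
  then show "connes G c \<in> conj_chains G x (Suc s)"
    unfolding connes_def by (intro chains.subspace_sum[OF sub] chains.subspace_scale[OF sub])
qed

end
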